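(* Let $\mathfrak{A}$ be a unital $C^*$-algebra. Then $\mathfrak{A}$ admits a diagonal sum on automorphism orbits if and only if all automorphisms of $\mathfrak{A}$ are locally inner.
   Context: Automorphisms are *-automorphisms; $\mathrm{Aut}(\cdot)$ denotes the group of all of them. $\mathbb{M}_2(\mathfrak{A}) = \mathbb{M}_2 \otimes \mathfrak{A}$ is the $C^*$-algebra of $2\times 2$ matrices over $\mathfrak{A}$. An automorphism $\theta$ of $\mathfrak{A}$ is locally inner if for every $x \in \mathfrak{A}$ there is a unitary $u_x \in \mathfrak{A}$ such that $\theta(x) = u_x x u_x^*$. The automorphism orbit of an element $x$ of a $C^*$-algebra $\mathfrak{B}$ is $[x] = \{\theta(x) \mid \theta \in \mathrm{Aut}(\mathfrak{B})\}$. For $x, y \in \mathfrak{A}$ the diagonal sum is $x \oplus_d y = \begin{pmatrix} x & 0 \\ 0 & y \end{pmatrix} \in \mathbb{M}_2(\mathfrak{A})$. One says that $\mathfrak{A}$ admits a diagonal sum on automorphism orbits if $([x],[y]) \mapsto [x \oplus_d y]$ is a well-defined map from pairs of automorphism orbits in $\mathfrak{A}$ to automorphism orbits in $\mathbb{M}_2(\mathfrak{A})$ (the orbit of $x \oplus_d y$ being taken under $\mathrm{Aut}(\mathbb{M}_2(\mathfrak{A}))$); equivalently, for all $\theta, \sigma \in \mathrm{Aut}(\mathfrak{A})$ and $x, y \in \mathfrak{A}$ there is $\gamma \in \mathrm{Aut}(\mathbb{M}_2(\mathfrak{A}))$ with $\gamma(x \oplus_d y) = \theta(x) \oplus_d \sigma(y)$.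 *)

theory Defs
  imports Complex_Main
begin

class scaleC =
  fixes scaleC :: "complex \<Rightarrow> 'a \<Rightarrow> 'a" (infixr "*\<^sub>C" 75)

class star =
  fixes star :: "'a \<Rightarrow> 'a"

text \<open>Unital complex *-algebras. The condition \<open>0 \<noteq> 1\<close> is deliberately not required
  (hence \<^class>\<open>ring\<close> and \<^class>\<open>monoid_mult\<close> in place of \<^class>\<open>ring_1\<close>), so that the zero
  algebra is included.\<close>

class unital_star_algebra = ring + monoid_mult + scaleC + star +
  assumes scaleC_add_right: "a *\<^sub>C (x + y) = a *\<^sub>C x + a *\<^sub>C y"
    and scaleC_add_left: "(a + b) *\<^sub>C x = a *\<^sub>C x + b *\<^sub>C x"
    and scaleC_scaleC: "a *\<^sub>C (b *\<^sub>C x) = (a * b) *\<^sub>C x"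
    and scaleC_one: "1 *\<^sub>C x = x"
    and mult_scaleC_left: "(a *\<^sub>C x) * y = a *\<^sub>C (x * y)"
    and mult_scaleC_right: "x * (a *\<^sub>C y) = a *\<^sub>C (x * y)"
    and star_add: "star (x + y) = star x + star y"
    and star_scaleC: "star (a *\<^sub>C x) = cnj a *\<^sub>C star x"
    and star_mult: "star (x * y) = star y * star x"
    and star_star: "star (star x) = x"

text \<open>Submultiplicativity of the norm and completeness come from \<^class>\<open>real_normed_algebra\<close>
  and \<^class>\<open>banach\<close>.\<close>

class unital_cstar_algebra = unital_star_algebra + real_normed_algebra + banach +
  assumes scaleR_eq_scaleC: "scaleR r x = of_real r *\<^sub>C x"
    and norm_scaleC: "norm (a *\<^sub>C x) = cmod a * norm x"
    and cstar_identity: "norm (star x * x) = (norm x)\<^sup>2"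

text \<open>\<open>Mat2 a b c d\<close> is the matrix with rows \<open>(a, b)\<close> and \<open>(c, d)\<close>. The *-algebra structure alone
  determines the *-automorphisms of the matrix algebra, so its C*-norm is not
  needed. The type \<open>'a ^ 2 ^ 2\<close> is not used because its \<open>*\<close> is the entrywise product, and matrix
  multiplication on it requires \<open>0 \<noteq> 1\<close> in \<open>'a\<close>.\<close>

datatype 'a mat2 = Mat2 'a 'a 'a 'a

instantiation mat2 :: (unital_star_algebra) unital_star_algebra
begin

definition zero_mat2 :: "'a mat2" where
  "0 = Mat2 0 0 0 0"

definition one_mat2 :: "'a mat2" where
  "1 = Mat2 1 0 0 1"

fun plus_mat2 :: "'a mat2 \<Rightarrow> 'a mat2 \<Rightarrow> 'a mat2" where
  "Mat2 a b c d + Mat2 a' b' c' d' = Mat2 (a + a') (b + b') (c + c') (d + d')"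

fun minus_mat2 :: "'a mat2 \<Rightarrow> 'a mat2 \<Rightarrow> 'a mat2" where
  "Mat2 a b c d - Mat2 a' b' c' d' = Mat2 (a - a') (b - b') (c - c') (d - d')"

fun uminus_mat2 :: "'a mat2 \<Rightarrow> 'a mat2" where
  "- Mat2 a b c d = Mat2 (- a) (- b) (- c) (- d)"

fun times_mat2 :: "'a mat2 \<Rightarrow> 'a mat2 \<Rightarrow> 'a mat2" where
  "Mat2 a b c d * Mat2 a' b' c' d' =
     Mat2 (a * a' + b * c') (a * b' + b * d') (c * a' + d * c') (c * b' + d * d')"

fun scaleC_mat2 :: "complex \<Rightarrow> 'a mat2 \<Rightarrow> 'a mat2" where
  "z *\<^sub>C Mat2 a b c d = Mat2 (z *\<^sub>C a) (z *\<^sub>C b) (z *\<^sub>C c) (z *\<^sub>C d)"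

fun star_mat2 :: "'a mat2 \<Rightarrow> 'a mat2" where
  "star (Mat2 a b c d) = Mat2 (star a) (star c) (star b) (star d)"

instance
proof
  fix X Y Z :: "'a mat2" and z w :: complex
  obtain a b c d where X: "X = Mat2 a b c d" by (cases X)
  obtain a' b' c' d' where Y: "Y = Mat2 a' b' c' d'" by (cases Y)
  obtain a'' b'' c'' d'' where Z: "Z = Mat2 a'' b'' c'' d''" by (cases Z)
  note [simp] = X Y Z zero_mat2_def one_mat2_def
  show "X + Y + Z = X + (Y + Z)" by (simp add: add.assoc)
  show "X + Y = Y + X" by (simp add: add.commute)
  show "0 + X = X" by simp
  show "- X + X = 0" by simp
  show "X - Y = X + - Y" by simp
  show "X * Y * Z = X * (Y * Z)" by (simp add: algebra_simps)
  show "(X + Y) * Z = X * Z + Y * Z" by (simp add: algebra_simps)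
  show "X * (Y + Z) = X * Y + X * Z" by (simp add: algebra_simps)
  show "1 * X = X" by simp
  show "X * 1 = X" by simp
  show "z *\<^sub>C (X + Y) = z *\<^sub>C X + z *\<^sub>C Y" by (simp add: scaleC_add_right)
  show "(z + w) *\<^sub>C X = z *\<^sub>C X + w *\<^sub>C X" by (simp add: scaleC_add_left)
  show "z *\<^sub>C (w *\<^sub>C X) = (z * w) *\<^sub>C X" by (simp add: scaleC_scaleC)
  show "1 *\<^sub>C X = X" by (simp add: scaleC_one)
  show "(z *\<^sub>C X) * Y = z *\<^sub>C (X * Y)" by (simp add: mult_scaleC_left scaleC_add_right)
  show "X * (z *\<^sub>C Y) = z *\<^sub>C (X * Y)" by (simp add: mult_scaleC_right scaleC_add_right)
  show "star (X + Y) = star X + star Y" by (simp add: star_add)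
  show "star (z *\<^sub>C X) = cnj z *\<^sub>C star X" by (simp add: star_scaleC)
  show "star (X * Y) = star Y * star X" by (simp add: star_mult star_add)
  show "star (star X) = X" by (simp add: star_star)
qed

end

definition star_automorphism :: "('a::unital_star_algebra \<Rightarrow> 'a) \<Rightarrow> bool" where
  "star_automorphism \<theta> \<longleftrightarrow>
     bij \<theta> \<and>
     (\<forall>x y. \<theta> (x + y) = \<theta> x + \<theta> y) \<and>
     (\<forall>a x. \<theta> (a *\<^sub>C x) = a *\<^sub>C \<theta> x) \<and>
     (\<forall>x y. \<theta> (x * y) = \<theta> x * \<theta> y) \<and>
     (\<forall>x. \<theta> (star x) = star (\<theta> x))"

definition unitary :: "'a::unital_star_algebra \<Rightarrow> bool" where
  "unitary u \<longleftrightarrow> star u * u = 1 \<and> u * star u = 1"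

definition locally_inner :: "('a::unital_star_algebra \<Rightarrow> 'a) \<Rightarrow> bool" where
  "locally_inner \<theta> \<longleftrightarrow> (\<forall>x. \<exists>u. unitary u \<and> \<theta> x = u * x * star u)"

definition automorphism_orbit :: "'a::unital_star_algebra \<Rightarrow> 'a set" where
  "automorphism_orbit x = {\<theta> x | \<theta>. star_automorphism \<theta>}"

definition diagonal_sum :: "'a::unital_star_algebra \<Rightarrow> 'a \<Rightarrow> 'a mat2" (infixl "\<oplus>\<^sub>d" 65) where
  "x \<oplus>\<^sub>d y = Mat2 x 0 0 y"

text \<open>Well-definedness of \<open>([x], [y]) \<mapsto> [x \<oplus>\<^sub>d y]\<close>, stated as the existence of a map with these
  values; its values outside the set of pairs of orbits are irrelevant.\<close>

definition admits_diagonal_sum_on_orbits :: "'a::unital_star_algebra itself \<Rightarrow> bool" where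
  "admits_diagonal_sum_on_orbits _ \<longleftrightarrow>
     (\<exists>S :: 'a set \<Rightarrow> 'a set \<Rightarrow> 'a mat2 set. \<forall>x y.
        S (automorphism_orbit x) (automorphism_orbit y) = automorphism_orbit (x \<oplus>\<^sub>d y))"

end

theory Submission
  imports Defs "HOL-Analysis.Elementary_Metric_Spaces"
begin

text \<open>
  For the non-trivial implication: given \<open>\<theta>\<close> and \<open>x\<close>, which may be scaled to be small together with \<open>\<theta> x\<close>, take \<open>\<gamma>\<close> with
  \<open>\<gamma> X = Y\<close> for \<open>X = x \<oplus>\<^sub>d (x + 1)\<close> and \<open>Y = \<theta> x \<oplus>\<^sub>d (x + 1)\<close>. The spectra of the two
  diagonal entries of \<open>star X * X\<close> are separated, which forces \<open>\<gamma>\<close> to fix the projection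
  \<open>p = 1 \<oplus>\<^sub>d 0\<close>. To see this without spectral theory, write
  \<open>1 - 2 star X * X = w\<^sup>2 \<oplus>\<^sub>d (- v\<^sup>2)\<close> with self-adjoint \<open>w\<close> and \<open>v\<close>; the image under \<open>\<gamma>\<close> is
  \<open>(\<theta> w)\<^sup>2 \<oplus>\<^sub>d (- v\<^sup>2)\<close>, and everything commuting with it is diagonal. So \<open>\<gamma> p = r \<oplus>\<^sub>d s\<close>,
  and the lower entry \<open>h\<close> of \<open>\<gamma> (w \<oplus>\<^sub>d 0)\<close> satisfies \<open>h\<^sup>2 = - v\<^sup>2 s\<close>. A vanishing sum of squares
  of two commuting self-adjoint elements is trivial, hence \<open>s = 0\<close>, and likewise \<open>1 - r = 0\<close>.
  As \<open>\<gamma>\<close> fixes \<open>p\<close>, it maps the matrix unit \<open>e\<^sub>1\<^sub>2\<close> to \<open>u e\<^sub>1\<^sub>2\<close> with \<open>u\<close> unitary, and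
  \<open>x \<oplus>\<^sub>d 0 = e\<^sub>1\<^sub>2 (0 \<oplus>\<^sub>d x) e\<^sub>2\<^sub>1\<close> gives \<open>\<theta> x = u * x * star u\<close>.
\<close>

section \<open>Unital *-algebras and their automorphisms\<close>

lemma star_zero [simp]: "star (0::'a::unital_star_algebra) = 0"
  using star_add[of 0 "0::'a"] by simp

lemma star_one [simp]: "star (1::'a::unital_star_algebra) = 1"
  by (metis mult_1_left mult_1_right star_mult star_star)

lemma star_minus: "star (- x) = - star (x::'a::unital_star_algebra)"
  by (metis ab_left_minus add_eq_0_iff star_add star_zero)

lemma star_diff: "star (x - y) = star x - star (y::'a::unital_star_algebra)"
  by (metis add_uminus_conv_diff star_add star_minus)

locale star_aut =
  fixes \<theta> :: "'a::unital_star_algebra \<Rightarrow> 'a"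
  assumes aut: "star_automorphism \<theta>"
begin

lemma bij: "bij \<theta>"
  and add: "\<theta> (x + y) = \<theta> x + \<theta> y"
  and scaleC: "\<theta> (a *\<^sub>C x) = a *\<^sub>C \<theta> x"
  and mult: "\<theta> (x * y) = \<theta> x * \<theta> y"
  and star: "\<theta> (star x) = star (\<theta> x)"
  using aut by (auto simp: star_automorphism_def)

lemma eq_iff: "\<theta> x = \<theta> y \<longleftrightarrow> x = y"
  using bij by (metis bij_pointE)

lemma surjE: obtains x where "y = \<theta> x"
  using bij by (metis bij_pointE)

lemma zero: "\<theta> 0 = 0"
  using add[of 0 0] by simp

lemma one: "\<theta> 1 = 1"
  by (metis mult mult_1_left mult_1_right surjE)

lemma diff: "\<theta> (x - y) = \<theta> x - \<theta> y"
  by (metis add add_diff_cancel diff_add_cancel)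

lemma inverse: "star_automorphism (inv \<theta>)"
proof -
  have i: "\<theta> (inv \<theta> x) = x" for x
    using bij by (simp add: bij_is_surj surj_f_inv_f)
  show ?thesis
    unfolding star_automorphism_def
    using bij by (auto simp: bij_imp_bij_inv eq_iff[symmetric] i add scaleC mult star)
qed

end

lemma star_automorphism_id: "star_automorphism (\<lambda>x. x)"
  by (auto simp: star_automorphism_def bij_def inj_def)

lemma star_automorphism_comp:
  assumes "star_automorphism \<theta>" "star_automorphism \<sigma>"
  shows "star_automorphism (\<lambda>x. \<theta> (\<sigma> x))"
  using assms bij_comp[of \<sigma> \<theta>] by (auto simp: star_automorphism_def comp_def)

section \<open>Automorphism orbits and well-definedness of the diagonal sum\<close>

lemma mem_automorphism_orbit_self: "x \<in> automorphism_orbit x"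
  using star_automorphism_id by (force simp: automorphism_orbit_def)

lemma automorphism_orbit_subset:
  assumes "star_automorphism \<theta>"
  shows "automorphism_orbit (\<theta> x) \<subseteq> automorphism_orbit x"
  using star_automorphism_comp[OF _ assms] by (auto simp: automorphism_orbit_def)

lemma automorphism_orbit_image:
  assumes "star_automorphism \<theta>"
  shows "automorphism_orbit (\<theta> x) = automorphism_orbit x"
proof -
  interpret star_aut \<theta> using assms by unfold_locales
  have "inv \<theta> (\<theta> x) = x"
    using bij by (simp add: bij_is_inj)
  then show ?thesis
    using automorphism_orbit_subset[OF assms, of x] automorphism_orbit_subset[OF inverse, of "\<theta> x"]
    by simp
qed

lemma star_automorphism_conjugation:
  assumes "unitary u"
  shows "star_automorphism (\<lambda>x. u * x * star u)"
proof -
  have u: "star u * (u * x) = x" "u * (star u * x) = x" for x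
    using assms by (simp_all add: unitary_def flip: mult.assoc)
  have "bij (\<lambda>x. u * x * star u)"
    by (rule o_bij[where g = "\<lambda>x. star u * x * u"])
      (use assms in \<open>auto simp: fun_eq_iff mult.assoc u unitary_def\<close>)
  then show ?thesis
    by (simp add: star_automorphism_def distrib_left distrib_right mult_scaleC_left
        mult_scaleC_right star_mult star_star mult.assoc u)
qed

lemma admits_diagonal_sum_on_orbits_iff:
  "admits_diagonal_sum_on_orbits TYPE('a::unital_star_algebra) \<longleftrightarrow>
     (\<forall>\<theta> \<sigma> (x::'a) y. star_automorphism \<theta> \<longrightarrow> star_automorphism \<sigma> \<longrightarrow>
        (\<exists>\<gamma>. star_automorphism \<gamma> \<and> \<gamma> (x \<oplus>\<^sub>d y) = \<theta> x \<oplus>\<^sub>d \<sigma> y))"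
  (is "?A \<longleftrightarrow> ?B")
proof
  assume ?A
  then obtain S :: "'a set \<Rightarrow> 'a set \<Rightarrow> 'a mat2 set" where
    S: "S (automorphism_orbit x) (automorphism_orbit y) = automorphism_orbit (x \<oplus>\<^sub>d y)" for x y
    unfolding admits_diagonal_sum_on_orbits_def by blast
  show ?B
  proof (intro allI impI)
    fix \<theta> \<sigma> :: "'a \<Rightarrow> 'a" and x y :: 'a
    assume "star_automorphism \<theta>" "star_automorphism \<sigma>"
    then have "automorphism_orbit (\<theta> x \<oplus>\<^sub>d \<sigma> y) = automorphism_orbit (x \<oplus>\<^sub>d y)"
      by (simp add: automorphism_orbit_image flip: S)
    then have "\<theta> x \<oplus>\<^sub>d \<sigma> y \<in> automorphism_orbit (x \<oplus>\<^sub>d y)"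
      using mem_automorphism_orbit_self by blast
    then show "\<exists>\<gamma>. star_automorphism \<gamma> \<and> \<gamma> (x \<oplus>\<^sub>d y) = \<theta> x \<oplus>\<^sub>d \<sigma> y"
      by (force simp: automorphism_orbit_def)
  qed
next
  assume B: ?B
  \<comment> \<open>Chosen representatives of the two orbits are automorphic images of
    \<open>x\<close> and \<open>y\<close>, so \<open>?B\<close> links their diagonal sum to that of
    \<open>x\<close> and \<open>y\<close> by a single automorphism.\<close>
  define rep :: "'a set \<Rightarrow> 'a" where "rep A = (SOME x. x \<in> A)" for A
  have "automorphism_orbit (rep (automorphism_orbit x) \<oplus>\<^sub>d rep (automorphism_orbit y))
      = automorphism_orbit (x \<oplus>\<^sub>d y)" for x y
  proof -
    have "rep (automorphism_orbit z) \<in> automorphism_orbit z" for z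
      unfolding rep_def by (rule someI) (rule mem_automorphism_orbit_self)
    then obtain \<theta> \<sigma> where "star_automorphism \<theta>" "rep (automorphism_orbit x) = \<theta> x"
      "star_automorphism \<sigma>" "rep (automorphism_orbit y) = \<sigma> y"
      unfolding automorphism_orbit_def by blast
    then show ?thesis
      using B by (metis automorphism_orbit_image)
  qed
  then show ?A
    unfolding admits_diagonal_sum_on_orbits_def
    by (intro exI[of _ "\<lambda>A B. automorphism_orbit (rep A \<oplus>\<^sub>d rep B)"]) blast
qed

section \<open>Diagonal matrices and automorphisms fixing a corner\<close>

lemma diagonal_sum_simps:
  "(x \<oplus>\<^sub>d y) + (x' \<oplus>\<^sub>d y') = (x + x') \<oplus>\<^sub>d (y + y')"
  "(x \<oplus>\<^sub>d y) - (x' \<oplus>\<^sub>d y') = (x - x') \<oplus>\<^sub>d (y - y')"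
  "(x \<oplus>\<^sub>d y) * (x' \<oplus>\<^sub>d y') = (x * x') \<oplus>\<^sub>d (y * y')"
  "- (x \<oplus>\<^sub>d y) = (- x) \<oplus>\<^sub>d (- y)"
  "star (x \<oplus>\<^sub>d y) = star x \<oplus>\<^sub>d star y"
  "x \<oplus>\<^sub>d y = x' \<oplus>\<^sub>d y' \<longleftrightarrow> x = x' \<and> y = y'"
  for x y :: "'a::unital_star_algebra"
  by (simp_all add: diagonal_sum_def)

lemma one_mat2_eq: "1 = 1 \<oplus>\<^sub>d (1::'a::unital_star_algebra)"
  by (simp add: diagonal_sum_def one_mat2_def)

lemma unitary_diagonal_sum:
  assumes "unitary u" "unitary v"
  shows "unitary (u \<oplus>\<^sub>d v)"
  using assms by (simp add: unitary_def diagonal_sum_simps one_mat2_eq)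

lemma unitary_equivalent_of_fixes_corner:
  fixes x y :: "'a::unital_star_algebra"
  assumes "star_automorphism \<gamma>" and corner: "\<gamma> (1 \<oplus>\<^sub>d 0) = 1 \<oplus>\<^sub>d 0"
    and \<gamma>: "\<gamma> (x \<oplus>\<^sub>d (x + 1)) = y \<oplus>\<^sub>d (x + 1)"
  obtains u where "unitary u" "y = u * x * star u"
proof -
  interpret star_aut \<gamma> using assms by unfold_locales
  let ?p = "1 \<oplus>\<^sub>d (0::'a)" and ?p' = "0 \<oplus>\<^sub>d (1::'a)"
  have corner': "\<gamma> ?p' = ?p'"
    using diff[of 1 ?p] by (simp add: one corner) (simp add: one_mat2_eq diagonal_sum_simps)
  have "\<gamma> (x \<oplus>\<^sub>d 0) = y \<oplus>\<^sub>d 0"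
    using mult[of "x \<oplus>\<^sub>d (x + 1)" ?p] by (simp add: corner \<gamma> diagonal_sum_simps)
  \<comment> \<open>The summand 1 in the lower entry is removed by subtracting the unit, which
    \<gamma> fixes; cutting down by \<open>?p'\<close> then leaves only \<open>x\<close>.\<close>
  moreover have "\<gamma> (0 \<oplus>\<^sub>d x) = 0 \<oplus>\<^sub>d x"
    using mult[of "x \<oplus>\<^sub>d (x + 1) - 1" ?p'] unfolding diff one corner' \<gamma>
    by (simp add: one_mat2_eq diagonal_sum_simps)
  moreover define E where "E = Mat2 0 (1::'a) 0 0"
  have E: "?p * E * ?p' = E" "E * star E = ?p" "star E * E = ?p'" "E * (0 \<oplus>\<^sub>d x) * star E = x \<oplus>\<^sub>d 0"
    by (simp_all add: E_def diagonal_sum_def)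
  obtain a u c d where "\<gamma> E = Mat2 a u c d"
    by (cases "\<gamma> E")
  moreover have "?p * \<gamma> E * ?p' = \<gamma> E"
    by (metis E(1) mult corner corner')
  ultimately have U: "\<gamma> E = Mat2 0 u 0 0"
    by (simp add: diagonal_sum_def)
  have "\<gamma> E * star (\<gamma> E) = ?p" "star (\<gamma> E) * \<gamma> E = ?p'"
    using E corner corner' by (metis mult star)+
  then have "unitary u"
    by (simp add: U unitary_def diagonal_sum_def)
  moreover have "\<gamma> E * (0 \<oplus>\<^sub>d x) * star (\<gamma> E) = y \<oplus>\<^sub>d 0"
    using E(4) \<open>\<gamma> (x \<oplus>\<^sub>d 0) = _\<close> \<open>\<gamma> (0 \<oplus>\<^sub>d x) = _\<close> by (metis mult star)
  then have "y = u * x * star u"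
    by (simp add: U diagonal_sum_def)
  ultimately show ?thesis
    by (rule that)
qed

section \<open>Square roots and commuting self-adjoint elements\<close>

lemma star_scaleR: "star (r *\<^sub>R x) = r *\<^sub>R star (x::'a::unital_cstar_algebra)"
  by (simp add: scaleR_eq_scaleC star_scaleC)

lemma norm_star: "norm (star x) = norm (x::'a::unital_cstar_algebra)"
proof -
  have le: "norm y \<le> norm (star y)" for y :: 'a
    using norm_mult_ineq[of "star y" y] by (cases "y = 0") (auto simp: cstar_identity power2_eq_square)
  show ?thesis
    using le[of x] le[of "star x"] by (simp add: star_star)
qed

lemma bounded_linear_star: "bounded_linear (star :: 'a::unital_cstar_algebra \<Rightarrow> 'a)"
  by (rule bounded_linear_intro[where K = 1]) (simp_all add: star_add star_scaleR norm_star)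

text \<open>Banach's fixed point theorem stands in for functional calculus: w = 1 - y with y the
  limit of an iteration inside a closed set. Injectivity follows from norm y < 1, as w t = 0 means t
  = y t.\<close>

lemma sqrt_near_one:
  fixes z :: "'a::unital_cstar_algebra"
  assumes z: "norm z < 1" "star z = z"
  shows "\<exists>w. w * w = 1 - z \<and> star w = w \<and> (\<forall>b. b * z = z * b \<longrightarrow> b * w = w * b) \<and>
    (\<forall>t. w * t = 0 \<longrightarrow> t = 0)"
proof -
  \<comment> \<open>Self-adjointness and commutation with everything that commutes with
    \<open>z\<close> are closed conditions; built into \<open>S\<close>, they pass to the fixed
    point.\<close>
  define S where "S = {y. norm y \<le> norm z} \<inter> {y. star y = y} \<inter>
    (\<Inter>b\<in>{b. b * z = z * b}. {y. b * y = y * b})"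
  \<comment> \<open>\<open>(1 - y)\<^sup>2 = 1 - z\<close> says that \<open>y\<close> is a fixed point of \<open>f\<close>.\<close>
  define f where "f y = (1/2) *\<^sub>R (z + y * y)" for y
  have "closed S"
    unfolding S_def
    by (intro closed_Int closed_INT ballI closed_Collect_le closed_Collect_eq continuous_intros
        bounded_linear.continuous_on[OF bounded_linear_star])
  have SD: "norm y \<le> norm z" "star y = y" "b * z = z * b \<Longrightarrow> b * y = y * b" if "y \<in> S" for b y
    using that by (auto simp: S_def)
  from \<open>closed S\<close> have "complete S"
    by (simp add: complete_eq_closed)
  moreover have "0 \<in> S"
    by (simp add: S_def)
  moreover have "f y \<in> S" if y: "y \<in> S" for y
  proof -
    have "norm (y * y) \<le> norm y * 1"
      using SD(1)[OF y] z by (intro order_trans[OF norm_mult_ineq mult_left_mono]) auto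
    then have "norm (f y) \<le> norm z"
      using SD(1)[OF y] norm_triangle_ineq[of z "y * y"] by (simp add: f_def)
    moreover have "b * f y = f y * b" if "b * z = z * b" for b
    proof -
      have "b * y = y * b"
        using y that by (rule SD)
      then have "b * (y * y) = y * y * b"
        by (metis mult.assoc)
      then show ?thesis
        by (simp add: f_def that distrib_left distrib_right)
    qed
    moreover have "star (f y) = f y"
      using SD(2)[OF y] z by (simp add: f_def star_scaleR star_add star_mult)
    ultimately show ?thesis
      by (auto simp: S_def)
  qed
  moreover have "dist (f y) (f y') \<le> norm z * dist y y'" if "y \<in> S" "y' \<in> S" for y y'
  proof -
    \<comment> \<open>The noncommutative difference of squares; the factor 1/2 in \<open>f\<close>
      then yields the contraction constant \<open>norm z\<close>.\<close>
    have "norm (y * y - y' * y') = norm (y * (y - y') + (y - y') * y')"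
      by (simp add: algebra_simps)
    also have "\<dots> \<le> norm y * norm (y - y') + norm (y - y') * norm y'"
      by (intro norm_triangle_mono norm_mult_ineq)
    also have "\<dots> \<le> norm z * norm (y - y') + norm (y - y') * norm z"
      using that by (intro add_mono mult_left_mono mult_right_mono) (auto dest: SD(1))
    finally have "norm (y * y - y' * y') \<le> 2 * (norm z * norm (y - y'))"
      by simp
    moreover have "f y - f y' = (1/2) *\<^sub>R (y * y - y' * y')"
      by (simp add: f_def scaleR_add_right scaleR_diff_right)
    ultimately show ?thesis
      by (simp add: dist_norm)
  qed
  ultimately have "\<exists>!y\<in>S. f y = y"
    using z by (intro Banach_fix[of S "norm z"]) auto
  then obtain y where y: "y \<in> S" "f y = y"
    by blast
  have "y + y = z + y * y"
    by (subst (1 2) y(2)[symmetric]) (simp add: f_def flip: scaleR_left_distrib)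
  then have "(1 - y) * (1 - y) = 1 - z"
    by (simp add: algebra_simps)
  moreover have "star (1 - y) = 1 - y"
    using SD(2)[OF y(1)] by (simp add: star_diff)
  moreover have "b * (1 - y) = (1 - y) * b" if "b * z = z * b" for b
    using SD(3)[OF y(1) that] by (simp add: algebra_simps)
  moreover have "t = 0" if "(1 - y) * t = 0" for t
  proof -
    have "t = y * t"
      using that by (simp add: algebra_simps)
    then have "norm t \<le> norm y * norm t"
      by (metis norm_mult_ineq)
    moreover have "norm y < 1"
      using SD(1)[OF y(1)] z by simp
    ultimately show ?thesis
      by (smt (verit) mult_le_cancel_right1 norm_ge_zero norm_eq_zero mult_less_cancel_right1)
  qed
  ultimately show ?thesis
    by blast
qed

text \<open>By commutativity, g + i n times its adjoint is g g + n n = 0, so the C*-identity kills g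
  + i n. Its adjoint g - i n vanishes too, and so does their difference 2 i n.\<close>

lemma sum_squares_eq_zero:
  fixes g n :: "'a::unital_cstar_algebra"
  assumes sa: "star g = g" "star n = n" and comm: "g * n = n * g" and eq: "g * g + n * n = 0"
  shows "n = 0"
proof -
  have minus: "(- a) *\<^sub>C x = - (a *\<^sub>C x)" for a and x :: 'a
    using scaleC_add_left[of "- a" a x] scaleC_add_left[of 0 0 x] by (simp add: eq_neg_iff_add_eq_0)
  have scaleC_diff: "a *\<^sub>C (x - y) = a *\<^sub>C x - a *\<^sub>C y" for a and x y :: 'a
    using scaleC_add_right[of a "x - y" y] by simp
  have "star (g + \<i> *\<^sub>C n) * (g + \<i> *\<^sub>C n) = g * g + n * n"
    by (simp add: star_add star_scaleC sa minus scaleC_scaleC scaleC_one distrib_left left_diff_distrib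
        scaleC_add_right mult_scaleC_left mult_scaleC_right comm)
      (simp add: scaleC_diff minus scaleC_scaleC scaleC_one)
  then have "g + \<i> *\<^sub>C n = 0"
    using cstar_identity[of "g + \<i> *\<^sub>C n"] by (simp add: eq)
  moreover from this have "star (g + \<i> *\<^sub>C n) = 0"
    by (simp only: star_zero)
  then have "g - \<i> *\<^sub>C n = 0"
    by (simp add: star_add star_scaleC sa minus)
  ultimately have "\<i> *\<^sub>C n + \<i> *\<^sub>C n = 0"
    by (metis add_diff_cancel_left' diff_0_right eq_iff_diff_eq_0 add.commute)
  then have "(2 * \<i>) *\<^sub>C n = 0"
    by (simp flip: scaleC_add_left)
  then show "n = 0"
    using norm_scaleC[of "2 * \<i>" n] by simp
qed

text \<open>Since \<open>t\<close> is a projection commuting with \<open>k\<close>, the self-adjoint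
  \<open>k * t\<close> has square \<open>k * k * t\<close>, so \<open>eq\<close> is a vanishing sum
  of two commuting squares.\<close>

lemma projection_eq_zero:
  fixes g k t :: "'a::unital_cstar_algebra"
  assumes "star g = g" "star k = k" "star t = t" "t * t = t"
    and comm: "g * k = k * g" "g * t = t * g" "k * t = t * k"
    and eq: "g * g = - (k * k * t)" and inj: "k * t = 0 \<Longrightarrow> t = 0"
  shows "t = 0"
proof (rule inj, rule sum_squares_eq_zero[of g])
  show "star (k * t) = k * t"
    using assms by (simp add: star_mult)
  show "g * (k * t) = k * t * g"
    using comm by (metis mult.assoc)
  have "k * t * (k * t) = k * k * t"
    using assms by (metis mult.assoc)
  then show "g * g + k * t * (k * t) = 0"
    by (simp add: eq)
qed fact

text \<open>The equation rearranges to 2 n = f n + n g, whose right side has norm below 2 norm n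
  unless n = 0. This replaces the argument by disjoint spectra.\<close>

lemma intertwiner_eq_zero:
  fixes f g n :: "'a::unital_cstar_algebra"
  assumes "norm f < 1" "norm g < 1" and eq: "(1 - f) * n = - (n * (1 - g))"
  shows "n = 0"
proof -
  have "n + n = f * n + n * g"
    using eq by (simp add: algebra_simps)
  then have "2 *\<^sub>R n = f * n + n * g"
    by (simp add: scaleR_2)
  then have "2 * norm n \<le> norm (f * n) + norm (n * g)"
    by (metis norm_triangle_ineq norm_scaleR abs_numeral)
  also have "\<dots> \<le> norm f * norm n + norm n * norm g"
    by (intro add_mono norm_mult_ineq)
  finally have "(2 - norm f - norm g) * norm n \<le> 0"
    by (simp add: algebra_simps)
  then show ?thesis
    using assms by (simp add: mult_le_0_iff)
qed

section \<open>Automorphisms of the matrix algebra\<close>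

lemma unitary_equivalent_small:
  fixes x :: "'a::unital_cstar_algebra"
  assumes aut: "star_automorphism \<theta>" "star_automorphism \<gamma>"
    and \<gamma>: "\<gamma> (x \<oplus>\<^sub>d (x + 1)) = \<theta> x \<oplus>\<^sub>d (x + 1)"
    and small: "norm x \<le> 1/10" "norm (\<theta> x) \<le> 1/10"
  obtains u where "unitary u" "\<theta> x = u * x * star u"
proof -
  interpret \<theta>: star_aut \<theta> using aut by unfold_locales
  interpret \<gamma>: star_aut \<gamma> using aut by unfold_locales
  have norm_square: "norm (star y * y) \<le> 1/100" if "norm y \<le> 1/10" for y :: 'a
    using that power_mono[of "norm y" "1/10" 2] by (simp add: cstar_identity power_divide)
  \<comment> \<open>Chosen so that 1 - 2 star X * X, with X =
    \<open>x \<oplus>\<^sub>d (x + 1)\<close>, has diagonal entries 1 - a and -(1 - e). The bound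
    1/10 gives norm e \<le> 2 (1/100 + 1/10 + 1/10) < 1.\<close>
  define a where "a = star x * x + star x * x"
  define e where "e = - (star x * x + star x + x + (star x * x + star x + x))"
  have star_a: "star a = a" and star_e: "star e = e"
    by (simp_all add: a_def e_def star_add star_mult star_star star_diff star_minus algebra_simps)
  have norm_a: "norm a < 1" and norm_\<theta>a: "norm (\<theta> a) < 1"
    using norm_square[OF small(1)] norm_square[OF small(2)]
    by (auto simp: a_def \<theta>.add \<theta>.mult \<theta>.star intro: order.strict_trans1[OF norm_triangle_ineq])
  have "norm (star x * x + star x + x) \<le> norm (star x * x) + norm (star x) + norm x"
    by (intro norm_triangle_mono order_refl)
  then have "norm (star x * x + star x + x) < 1/2"
    using norm_square[OF small(1)] small by (simp add: norm_star)
  then have norm_e: "norm e < 1"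
    unfolding e_def norm_minus_cancel by (intro order.strict_trans1[OF norm_triangle_ineq]) simp
  obtain w where w: "w * w = 1 - a" "star w = w" "\<And>b. b * a = a * b \<Longrightarrow> b * w = w * b"
    "\<And>t. w * t = 0 \<Longrightarrow> t = 0"
    using sqrt_near_one[OF norm_a star_a] by blast
  obtain v where v: "v * v = 1 - e" "star v = v" "\<And>b. b * e = e * b \<Longrightarrow> b * v = v * b"
    "\<And>t. v * t = 0 \<Longrightarrow> t = 0"
    using sqrt_near_one[OF norm_e star_e] by blast
  \<comment> \<open>Transporting \<open>w\<close> along \<theta> gives a root of 1 - \<theta> a; its
    commutation and injectivity properties carry over because \<theta> is bijective.\<close>
  define c where "c = \<theta> w"
  have c: "c * c = 1 - \<theta> a" "star c = c"
    using \<theta>.mult[of w w] \<theta>.star[of w] by (simp_all add: c_def w(1,2) \<theta>.one \<theta>.diff)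
  have c_comm: "b * c = c * b" if "b * \<theta> a = \<theta> a * b" for b
  proof -
    obtain b' where "b = \<theta> b'"
      by (rule \<theta>.surjE)
    then show ?thesis
      using that w(3)[of b'] by (simp add: c_def \<theta>.eq_iff flip: \<theta>.mult)
  qed
  have c_inj: "t = 0" if "c * t = 0" for t
  proof -
    obtain t' where "t = \<theta> t'"
      by (rule \<theta>.surjE)
    then show ?thesis
      using that w(4)[of t'] \<theta>.eq_iff[of _ 0] by (simp add: c_def \<theta>.zero flip: \<theta>.mult)
  qed
  let ?X = "x \<oplus>\<^sub>d (x + 1)" and ?Y = "\<theta> x \<oplus>\<^sub>d (x + 1)"
  \<comment> \<open>\<open>T\<close> is a polynomial in \<open>?X\<close> and its adjoint, hence \<open>\<gamma> T\<close> is the same polynomial in \<open>?Y\<close>.\<close>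
  define T where "T = (w * w) \<oplus>\<^sub>d (- (v * v))"
  define T' where "T' = (c * c) \<oplus>\<^sub>d (- (v * v))"
  have "T = 1 - star ?X * ?X - star ?X * ?X"
    by (simp add: T_def one_mat2_eq diagonal_sum_simps w v star_add a_def e_def algebra_simps)
  moreover have "T' = 1 - star ?Y * ?Y - star ?Y * ?Y"
    by (simp add: T'_def one_mat2_eq diagonal_sum_simps c v star_add a_def e_def algebra_simps
        \<theta>.add \<theta>.mult \<theta>.star)
  ultimately have \<gamma>T: "\<gamma> T = T'"
    by (simp add: \<gamma>.diff \<gamma>.one \<gamma>.mult \<gamma>.star \<gamma>)
  \<comment> \<open>\<gamma> N commutes with \<open>T'\<close>. Its off-diagonal entries intertwine
    1 - \<theta> a with -(1 - e), up to order, and so vanish; the diagonal ones commute with the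
    squares of \<open>c\<close> and \<open>v\<close>, hence with the roots.\<close>
  have diag: "\<exists>g h. \<gamma> N = g \<oplus>\<^sub>d h \<and> g * c = c * g \<and> h * v = v * h" if "N * T = T * N" for N
  proof -
    obtain g n m h where N: "\<gamma> N = Mat2 g n m h"
      by (cases "\<gamma> N")
    have "\<gamma> N * T' = T' * \<gamma> N"
      using that by (metis \<gamma>.mult \<gamma>T)
    then have *: "g * (c * c) = c * c * g" "- (n * (v * v)) = c * c * n"
        "m * (c * c) = - (v * v * m)" "h * (v * v) = v * v * h"
      by (simp_all add: N T'_def diagonal_sum_def)
    have "n = 0"
      using * norm_\<theta>a norm_e by (intro intertwiner_eq_zero[of "\<theta> a" e]) (simp_all add: c v)
    moreover have "m = 0"
      using * norm_\<theta>a norm_e by (intro intertwiner_eq_zero[of e "\<theta> a"]) (simp_all add: c v)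
    moreover have "g * \<theta> a = \<theta> a * g" "h * e = e * h"
      using * by (simp_all add: c v algebra_simps)
    ultimately show ?thesis
      using N c_comm v(3) by (auto simp: diagonal_sum_def)
  qed
  let ?p = "1 \<oplus>\<^sub>d (0::'a)"
  obtain r s where q: "\<gamma> ?p = r \<oplus>\<^sub>d s" and rc: "r * c = c * r" and sv: "s * v = v * s"
    using diag[of ?p] by (auto simp: T_def diagonal_sum_simps)
  have "star ?p = ?p" "?p * ?p = ?p"
    by (simp_all add: diagonal_sum_simps)
  then have "star (\<gamma> ?p) = \<gamma> ?p" "\<gamma> ?p * \<gamma> ?p = \<gamma> ?p"
    by (metis \<gamma>.star, metis \<gamma>.mult)
  then have rs: "star r = r" "star s = s" "r * r = r" "s * s = s"
    by (simp_all add: q diagonal_sum_simps)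
  have "s = 0"
  proof -
    obtain g h where G: "\<gamma> (w \<oplus>\<^sub>d 0) = g \<oplus>\<^sub>d h" and hv: "h * v = v * h"
      using diag[of "w \<oplus>\<^sub>d 0"] by (auto simp: T_def diagonal_sum_simps mult.assoc)
    have *: "star (w \<oplus>\<^sub>d 0) = w \<oplus>\<^sub>d 0" "(w \<oplus>\<^sub>d 0) * (w \<oplus>\<^sub>d 0) = T * ?p"
        "(w \<oplus>\<^sub>d 0) * ?p = ?p * (w \<oplus>\<^sub>d 0)"
      by (simp_all add: w(2) T_def diagonal_sum_simps)
    have "star (g \<oplus>\<^sub>d h) = g \<oplus>\<^sub>d h" "(g \<oplus>\<^sub>d h) * (g \<oplus>\<^sub>d h) = T' * (r \<oplus>\<^sub>d s)"
        "(g \<oplus>\<^sub>d h) * (r \<oplus>\<^sub>d s) = (r \<oplus>\<^sub>d s) * (g \<oplus>\<^sub>d h)"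
      using *[THEN arg_cong[where f = \<gamma>]] by (simp_all only: \<gamma>.star \<gamma>.mult G q \<gamma>T)
    then have h: "star h = h" "h * s = s * h" "h * h = - (v * v * s)"
      by (simp_all add: T'_def diagonal_sum_simps)
    show ?thesis
      using projection_eq_zero[OF h(1) v(2) rs(2,4) hv h(2) sv[symmetric] h(3) v(4)] by blast
  qed
  moreover have "1 - r = 0"
  proof -
    obtain g h where G: "\<gamma> (0 \<oplus>\<^sub>d v) = g \<oplus>\<^sub>d h" and gc: "g * c = c * g"
      using diag[of "0 \<oplus>\<^sub>d v"] by (auto simp: T_def diagonal_sum_simps mult.assoc)
    \<comment> \<open>The mirror image of the previous case: T p - T is 0 in the upper and
      \<open>v * v\<close> in the lower corner, and its image has upper entry c c r - c c = - c c (1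
      - r).\<close>
    have *: "star (0 \<oplus>\<^sub>d v) = 0 \<oplus>\<^sub>d v" "(0 \<oplus>\<^sub>d v) * (0 \<oplus>\<^sub>d v) = T * ?p - T"
        "(0 \<oplus>\<^sub>d v) * ?p = ?p * (0 \<oplus>\<^sub>d v)"
      by (simp_all add: v(2) T_def diagonal_sum_simps)
    have "star (g \<oplus>\<^sub>d h) = g \<oplus>\<^sub>d h" "(g \<oplus>\<^sub>d h) * (g \<oplus>\<^sub>d h) = T' * (r \<oplus>\<^sub>d s) - T'"
        "(g \<oplus>\<^sub>d h) * (r \<oplus>\<^sub>d s) = (r \<oplus>\<^sub>d s) * (g \<oplus>\<^sub>d h)"
      using *[THEN arg_cong[where f = \<gamma>]] by (simp_all only: \<gamma>.star \<gamma>.mult \<gamma>.diff G q \<gamma>T)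
    then have g: "star g = g" "g * (1 - r) = (1 - r) * g" "g * g = - (c * c * (1 - r))"
      by (simp_all add: T'_def diagonal_sum_simps right_diff_distrib left_diff_distrib)
    have r: "star (1 - r) = 1 - r" "(1 - r) * (1 - r) = 1 - r" "c * (1 - r) = (1 - r) * c"
      by (simp_all add: rs rc star_diff right_diff_distrib left_diff_distrib)
    show ?thesis
      using projection_eq_zero[OF g(1) c(2) r(1,2) gc g(2) r(3) g(3) c_inj] by blast
  qed
  ultimately have "\<gamma> ?p = ?p"
    by (simp add: q diagonal_sum_simps)
  then show ?thesis
    using unitary_equivalent_of_fixes_corner[OF aut(2) _ \<gamma>] that by blast
qed

theorem corollary3p5:
  "admits_diagonal_sum_on_orbits TYPE('a::unital_cstar_algebra) \<longleftrightarrow>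
     (\<forall>\<theta> :: 'a \<Rightarrow> 'a. star_automorphism \<theta> \<longrightarrow> locally_inner \<theta>)"
  (is "?A \<longleftrightarrow> ?B")
proof
  assume A: ?A
  show ?B
    unfolding locally_inner_def
  proof (intro allI impI)
    fix \<theta> :: "'a \<Rightarrow> 'a" and x :: 'a
    assume \<theta>: "star_automorphism \<theta>"
    then interpret star_aut \<theta> by unfold_locales
    \<comment> \<open>The summand 1 keeps \<open>K\<close> positive even for x = 0; the factor 10
      matches the smallness bound 1/10.\<close>
    define K where "K = 10 * (1 + norm x + norm (\<theta> x))"
    define y where "y = (1 / K) *\<^sub>R x"
    have K: "K > 0" "10 * norm x \<le> K" "10 * norm (\<theta> x) \<le> K"
      using norm_ge_zero[of x] norm_ge_zero[of "\<theta> x"] by (simp_all add: K_def add.assoc add_pos_nonneg)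
    have \<theta>y: "\<theta> y = (1 / K) *\<^sub>R \<theta> x"
      by (simp add: y_def scaleR_eq_scaleC scaleC)
    obtain \<gamma> where "star_automorphism \<gamma>" "\<gamma> (y \<oplus>\<^sub>d (y + 1)) = \<theta> y \<oplus>\<^sub>d (y + 1)"
      using A \<theta> star_automorphism_id unfolding admits_diagonal_sum_on_orbits_iff by blast
    moreover have "norm y \<le> 1/10" "norm (\<theta> y) \<le> 1/10"
      using K by (simp_all add: \<theta>y) (simp_all add: y_def field_simps)
    ultimately obtain u where u: "unitary u" "\<theta> y = u * y * star u"
      using unitary_equivalent_small \<theta> by metis
    from u(2) have "(1 / K) *\<^sub>R \<theta> x = (1 / K) *\<^sub>R (u * x * star u)"
      by (simp only: \<theta>y) (simp add: y_def)
    then have "\<theta> x = u * x * star u"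
      using K(1) by simp
    with u(1) show "\<exists>u. unitary u \<and> \<theta> x = u * x * star u"
      by blast
  qed
next
  assume B: ?B
  show ?A
    unfolding admits_diagonal_sum_on_orbits_iff
  proof (intro allI impI)
    fix \<theta> \<sigma> :: "'a \<Rightarrow> 'a" and x y :: 'a
    assume "star_automorphism \<theta>" "star_automorphism \<sigma>"
    then obtain u v where uv: "unitary u" "\<theta> x = u * x * star u" "unitary v" "\<sigma> y = v * y * star v"
      using B unfolding locally_inner_def by meson
    \<comment> \<open>The unitaries depend on \<open>x\<close> and \<open>y\<close>, which is
      harmless because \<gamma> may depend on them as well.\<close>
    have "(\<lambda>z. (u \<oplus>\<^sub>d v) * z * star (u \<oplus>\<^sub>d v)) (x \<oplus>\<^sub>d y) = \<theta> x \<oplus>\<^sub>d \<sigma> y"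
      by (simp add: uv diagonal_sum_simps)
    then show "\<exists>\<gamma>. star_automorphism \<gamma> \<and> \<gamma> (x \<oplus>\<^sub>d y) = \<theta> x \<oplus>\<^sub>d \<sigma> y"
      using star_automorphism_conjugation[OF unitary_diagonal_sum[OF uv(1,3)]] by blast
  qed
qed

end
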